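(* For every integer $n>0$ there exist a $\mathrm{CAT}(0)$ space $X$ and an action of $\mathrm{PAut}(F_n)$ on $X$ by isometries, i.e. a homomorphism $\mathrm{PAut}(F_n)\to\mathrm{Isom}(X)$, such that the action is non-abelian (that is, the image of this homomorphism is a non-abelian group) and every partial conjugation $c_{ij}$ ($1\le i,j\le n$, $i\ne j$) acts on $X$ as a hyperbolic isometry.
   Context: $F_n$ is the free group with basis $v_1,\dots,v_n$. $\mathrm{PAut}(F_n)$ is the group of automorphisms of $F_n$ that send every basis element $v_i$ to a conjugate of itself. For $i\neq j$, the partial conjugation $c_{ij}$ is the automorphism of $F_n$ sending $v_i$ to $v_j^{-1}v_iv_j$ and fixing every other basis element. $\mathrm{Isom}(X)$ denotes the group of isometries of $X$. An isometry $g$ of a metric space $X$ is hyperbolic if its displacement function $x\mapsto d(x,gx)$ attains its infimum and this infimum is strictly positive.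
   Formalization: The action is claimed to be non-abelian only for n ≥ 2: for n = 1 the group PAut(F_1) is trivial, so no action of it has non-abelian image; the rest is still asserted for n = 1. *)

theory Defs
  imports "HOL-Analysis.Analysis" "HOL-Algebra.Bij"
begin

section \<open>Free groups\<close>

text \<open>
  A letter is a pair \<open>(b, i)\<close>: it stands for the basis element \<open>v\<^sub>i\<close> if \<open>b\<close> is true and for
  \<open>v\<^sub>i\<close> inverse otherwise.  The elements of the free group are the reduced words.
\<close>

type_synonym letter = "bool \<times> nat"

definition flip :: "letter \<Rightarrow> letter" where
  "flip x = (\<not> fst x, snd x)"

fun reduced :: "letter list \<Rightarrow> bool" where
  "reduced (x # y # w) \<longleftrightarrow> y \<noteq> flip x \<and> reduced (y # w)"
| "reduced w \<longleftrightarrow> True"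

text \<open>The product of a letter with a reduced word.\<close>

fun push :: "letter \<Rightarrow> letter list \<Rightarrow> letter list" where
  "push x [] = [x]"
| "push x (y # w) = (if y = flip x then w else x # y # w)"

definition free_group :: "nat \<Rightarrow> letter list monoid" where
  "free_group n = \<lparr>carrier = {w. reduced w \<and> snd ` set w \<subseteq> {1..n}}, mult = foldr push, one = []\<rparr>"

definition basis :: "nat \<Rightarrow> letter list" where
  "basis i = [(True, i)]"

text \<open>
  \<open>lift G n f\<close> is the homomorphism from the free group to \<open>G\<close> that sends \<open>basis i\<close> to \<open>f i\<close>;
  see \<open>lift_hom\<close>, \<open>lift_basis\<close> and \<open>free_group_hom_unique\<close> below.
\<close>

definition lift :: "('a, 'b) monoid_scheme \<Rightarrow> nat \<Rightarrow> (nat \<Rightarrow> 'a) \<Rightarrow> letter list \<Rightarrow> 'a" where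
  "lift G n f = (\<lambda>w \<in> carrier (free_group n).
     foldr (\<lambda>(b, i) g. (if b then f i else inv\<^bsub>G\<^esub> f i) \<otimes>\<^bsub>G\<^esub> g) w \<one>\<^bsub>G\<^esub>)"

lemma flip_flip [simp]: "flip (flip x) = x"
  by (simp add: flip_def)

lemma flip_neq [simp]: "flip x \<noteq> x" "x \<noteq> flip x"
  by (auto simp: flip_def prod_eq_iff)

lemma reduced_tl: "reduced (x # w) \<Longrightarrow> reduced w"
  by (cases w) auto

lemma reduced_push: "reduced w \<Longrightarrow> reduced (push x w)"
  by (cases w) (auto dest: reduced_tl)

lemma push_flip: "reduced w \<Longrightarrow> push x (push (flip x) w) = w"
  by (cases w rule: reduced.cases) auto

lemma push_flip': "reduced w \<Longrightarrow> push (flip x) (push x w) = w"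
  using push_flip[of w "flip x"] by simp

lemma push_reduced: "reduced (x # w) \<Longrightarrow> push x w = x # w"
  by (cases w) auto

lemma set_push: "set (push x w) \<subseteq> insert x (set w)"
  by (cases w) auto

lemma reduced_foldr_push: "reduced w \<Longrightarrow> reduced (foldr push u w)"
  by (induction u) (auto intro: reduced_push)

lemma set_foldr_push: "set (foldr push u w) \<subseteq> set u \<union> set w"
proof (induction u)
  case (Cons x u)
  then show ?case using set_push[of x "foldr push u w"] by auto
qed auto

lemma foldr_push_Nil: "reduced u \<Longrightarrow> foldr push u [] = u"
proof (induction u)
  case (Cons x u)
  then show ?case using reduced_tl[of x u] push_reduced[of x u] by simp
qed simp

lemma foldr_push_push:
  assumes "reduced w"
  shows "foldr push (push x z) w = push x (foldr push z w)"
  by (cases z) (use assms push_flip reduced_foldr_push in auto)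

lemma foldr_push_assoc:
  assumes "reduced w"
  shows "foldr push (foldr push u v) w = foldr push u (foldr push v w)"
  by (induction u) (auto simp: foldr_push_push assms)

lemma foldr_push_inverse:
  "reduced w \<Longrightarrow> foldr push (rev (map flip u)) (foldr push u w) = w"
  by (induction u) (auto simp: push_flip' reduced_foldr_push)

theorem group_free_group: "group (free_group n)"
proof (rule groupI)
  fix u assume u: "u \<in> carrier (free_group n)"
  let ?y = "foldr push (rev (map flip u)) []"
  have "?y \<in> carrier (free_group n)"
    using u set_foldr_push[of "rev (map flip u)" "[]"]
    by (fastforce simp: free_group_def reduced_foldr_push flip_def)
  moreover have "?y \<otimes>\<^bsub>free_group n\<^esub> u = \<one>\<^bsub>free_group n\<^esub>"
    using u foldr_push_inverse[of "[]" u]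
    by (simp add: free_group_def foldr_push_assoc foldr_push_Nil)
  ultimately show "\<exists>y\<in>carrier (free_group n). y \<otimes>\<^bsub>free_group n\<^esub> u = \<one>\<^bsub>free_group n\<^esub>"
    by blast
next
  fix u v assume "u \<in> carrier (free_group n)" "v \<in> carrier (free_group n)"
  then show "u \<otimes>\<^bsub>free_group n\<^esub> v \<in> carrier (free_group n)"
    using set_foldr_push[of u v] by (fastforce simp: free_group_def reduced_foldr_push)
qed (auto simp: free_group_def foldr_push_assoc)

lemma basis_in_carrier: "i \<in> {1..n} \<Longrightarrow> basis i \<in> carrier (free_group n)"
  by (auto simp: basis_def free_group_def)

lemma inv_basis: "i \<in> {1..n} \<Longrightarrow> inv\<^bsub>free_group n\<^esub> (basis i) = [(False, i)]"
  by (rule group.inv_equality[OF group_free_group])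
     (auto simp: basis_def free_group_def flip_def)

lemma Cons_eq_mult:
  assumes "(b, i) # w \<in> carrier (free_group n)"
  shows "i \<in> {1..n}" "w \<in> carrier (free_group n)"
    "(b, i) # w = (if b then basis i else inv\<^bsub>free_group n\<^esub> (basis i)) \<otimes>\<^bsub>free_group n\<^esub> w"
proof -
  show i: "i \<in> {1..n}" and "w \<in> carrier (free_group n)"
    using assms by (auto simp: free_group_def dest: reduced_tl)
  show "(b, i) # w = (if b then basis i else inv\<^bsub>free_group n\<^esub> (basis i)) \<otimes>\<^bsub>free_group n\<^esub> w"
    using assms push_reduced[of "(b, i)" w]
    by (auto simp: inv_basis[OF i]) (auto simp: free_group_def basis_def)
qed

theorem lift_hom:
  fixes G (structure)
  assumes "group G" and f: "f \<in> {1..n} \<rightarrow> carrier G"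
  shows "lift G n f \<in> hom (free_group n) G"
proof -
  interpret group G by fact
  define l where "l = (\<lambda>x::letter. if fst x then f (snd x) else inv f (snd x))"
  define L where "L = (\<lambda>w. foldr (\<lambda>x g. l x \<otimes> g) w \<one>)"
  have L_eq: "lift G n f w = L w" if "w \<in> carrier (free_group n)" for w
    using that by (simp add: lift_def L_def l_def case_prod_unfold)
  have l_closed: "l x \<in> carrier G" if "snd x \<in> {1..n}" for x
    using f that by (auto simp: l_def Pi_iff)
  have l_flip: "l x \<otimes> l (flip x) = \<one>" if "snd x \<in> {1..n}" for x
    using f that by (auto simp: l_def flip_def Pi_iff)
  have L_closed: "L w \<in> carrier G" if "snd ` set w \<subseteq> {1..n}" for w
    using that by (induction w) (auto simp: L_def l_closed)
  have L_push: "L (push x w) = l x \<otimes> L w" if "snd x \<in> {1..n}" "snd ` set w \<subseteq> {1..n}" for x w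
  proof (cases w)
    case (Cons y z)
    show ?thesis
    proof (cases "y = flip x")
      case True
      have "l x \<otimes> L w = l x \<otimes> (l (flip x) \<otimes> L z)"
        using Cons True by (simp add: L_def)
      also have "\<dots> = (l x \<otimes> l (flip x)) \<otimes> L z"
        using that Cons True L_closed[of z] l_closed[of x] l_closed[of "flip x"]
        by (intro m_assoc[symmetric]) auto
      also have "\<dots> = L z"
        using that Cons L_closed[of z] l_flip[of x] by auto
      finally show ?thesis using Cons True by simp
    next
      case False
      then show ?thesis using Cons by (simp add: L_def)
    qed
  qed (simp add: L_def)
  have L_mult: "L (foldr push u v) = L u \<otimes> L v"
    if "snd ` set u \<subseteq> {1..n}" "snd ` set v \<subseteq> {1..n}" for u v
    using that(1)
  proof (induction u)
    case Nil
    then show ?case using L_closed[OF that(2)] by (simp add: L_def)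
  next
    case (Cons x u)
    have "snd ` set (foldr push u v) \<subseteq> {1..n}"
      using set_foldr_push[of u v] Cons.prems that(2) by fastforce
    then have "L (foldr push (x # u) v) = l x \<otimes> (L u \<otimes> L v)"
      using Cons by (simp add: L_push)
    also have "\<dots> = (l x \<otimes> L u) \<otimes> L v"
      using Cons.prems that(2) by (intro m_assoc[symmetric] L_closed l_closed) auto
    also have "l x \<otimes> L u = L (x # u)" by (simp add: L_def)
    finally show ?case .
  qed
  show ?thesis
  proof (rule homI)
    fix u v assume u: "u \<in> carrier (free_group n)" and v: "v \<in> carrier (free_group n)"
    then have "u \<otimes>\<^bsub>free_group n\<^esub> v \<in> carrier (free_group n)"
      using group.is_monoid[OF group_free_group] by (simp add: monoid.m_closed)
    with u v show "lift G n f (u \<otimes>\<^bsub>free_group n\<^esub> v) = lift G n f u \<otimes> lift G n f v"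
      using L_mult by (simp add: L_eq) (simp add: free_group_def)
  next
    fix u assume "u \<in> carrier (free_group n)"
    then show "lift G n f u \<in> carrier G"
      using L_closed by (simp add: L_eq) (simp add: free_group_def)
  qed
qed

lemma lift_basis:
  assumes "group G" "f \<in> {1..n} \<rightarrow> carrier G" "i \<in> {1..n}"
  shows "lift G n f (basis i) = f i"
proof -
  interpret group G by fact
  show ?thesis
    using assms basis_in_carrier[of i n] by (auto simp: lift_def basis_def Pi_iff)
qed

theorem free_group_hom_unique:
  assumes "group G" and h: "h \<in> hom (free_group n) G" and k: "k \<in> hom (free_group n) G"
    and eq: "\<And>i. i \<in> {1..n} \<Longrightarrow> h (basis i) = k (basis i)"
    and "w \<in> carrier (free_group n)"
  shows "h w = k w"
proof -
  interpret h: group_hom "free_group n" G h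
    using assms group_free_group by (simp add: group_hom_def group_hom_axioms_def)
  interpret k: group_hom "free_group n" G k
    using assms group_free_group by (simp add: group_hom_def group_hom_axioms_def)
  show ?thesis
    using \<open>w \<in> carrier (free_group n)\<close>
  proof (induction w)
    case Nil
    then show ?case using h.hom_one k.hom_one by (simp add: free_group_def)
  next
    case (Cons x w)
    obtain b i where x: "x = (b, i)" by (cases x)
    note C = Cons_eq_mult[OF Cons.prems[unfolded x]]
    show ?case
      using C(1,2) Cons.IH eq[OF C(1)] basis_in_carrier[OF C(1)]
      unfolding x C(3) by simp
  qed
qed


lemma (in group) cancel_inv:
  assumes "x \<in> carrier G" "y \<in> carrier G"
  shows "inv x \<otimes> (x \<otimes> y) = y" "x \<otimes> (inv x \<otimes> y) = y"
  using assms by (simp_all flip: m_assoc)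


section \<open>The pure automorphism group and partial conjugations\<close>

definition PAut :: "nat \<Rightarrow> (letter list \<Rightarrow> letter list) monoid" where
  "PAut n = AutoGroup (free_group n)
     \<lparr>carrier := {\<phi> \<in> auto (free_group n). \<forall>i\<in>{1..n}. \<exists>g\<in>carrier (free_group n).
        \<phi> (basis i) = inv\<^bsub>free_group n\<^esub> g \<otimes>\<^bsub>free_group n\<^esub> basis i \<otimes>\<^bsub>free_group n\<^esub> g}\<rparr>"

definition partial_conj :: "nat \<Rightarrow> nat \<Rightarrow> nat \<Rightarrow> letter list \<Rightarrow> letter list" where
  "partial_conj n i j = lift (free_group n) n (\<lambda>k.
     if k = i then inv\<^bsub>free_group n\<^esub> basis j \<otimes>\<^bsub>free_group n\<^esub> basis i \<otimes>\<^bsub>free_group n\<^esub> basis j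
     else basis k)"

theorem group_PAut: "group (PAut n)"
proof -
  let ?F = "free_group n"
  interpret F: group ?F by (rule group_free_group)
  interpret A: group "AutoGroup ?F" by (rule F.AutoGroup)
  have hom: "\<phi> \<in> hom ?F ?F" if "\<phi> \<in> auto ?F" for \<phi>
    using that by (simp add: auto_def)
  have conj: "\<phi> (inv\<^bsub>?F\<^esub> g \<otimes>\<^bsub>?F\<^esub> v \<otimes>\<^bsub>?F\<^esub> g) = inv\<^bsub>?F\<^esub> \<phi> g \<otimes>\<^bsub>?F\<^esub> \<phi> v \<otimes>\<^bsub>?F\<^esub> \<phi> g"
    and closed: "\<phi> g \<in> carrier ?F"
    if "\<phi> \<in> auto ?F" "g \<in> carrier ?F" "v \<in> carrier ?F" for \<phi> g v
  proof -
    interpret h: group_hom ?F ?F \<phi>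
      using that hom by unfold_locales auto
    show "\<phi> (inv\<^bsub>?F\<^esub> g \<otimes>\<^bsub>?F\<^esub> v \<otimes>\<^bsub>?F\<^esub> g) = inv\<^bsub>?F\<^esub> \<phi> g \<otimes>\<^bsub>?F\<^esub> \<phi> v \<otimes>\<^bsub>?F\<^esub> \<phi> g" "\<phi> g \<in> carrier ?F"
      using that by simp_all
  qed
  have auto_Bij: "auto ?F \<subseteq> Bij (carrier ?F)" by (auto simp: auto_def)
  have mult: "(\<phi> \<otimes>\<^bsub>AutoGroup ?F\<^esub> \<psi>) w = \<phi> (\<psi> w)"
    if "\<phi> \<in> auto ?F" "\<psi> \<in> auto ?F" "w \<in> carrier ?F" for \<phi> \<psi> w
    using that auto_Bij by (simp add: AutoGroup_def BijGroup_def compose_def subset_iff)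
  have car: "carrier (AutoGroup ?F) = auto ?F" by (simp add: AutoGroup_def)
  let ?P = "{\<phi> \<in> auto ?F. \<forall>i\<in>{1..n}. \<exists>g\<in>carrier ?F.
        \<phi> (basis i) = inv\<^bsub>?F\<^esub> g \<otimes>\<^bsub>?F\<^esub> basis i \<otimes>\<^bsub>?F\<^esub> g}"
  have "subgroup ?P (AutoGroup ?F)"
  proof (rule A.subgroupI)
    show "?P \<subseteq> carrier (AutoGroup ?F)" by (auto simp: car)
    have "\<one>\<^bsub>AutoGroup ?F\<^esub> \<in> ?P"
      using F.id_in_auto basis_in_carrier
      by (auto simp: AutoGroup_def BijGroup_def intro!: bexI[of _ "\<one>\<^bsub>?F\<^esub>"])
    then show "?P \<noteq> {}" by blast
  next
    fix \<phi> assume \<phi>: "\<phi> \<in> ?P"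
    define \<psi> where "\<psi> = inv\<^bsub>AutoGroup ?F\<^esub> \<phi>"
    have \<psi>: "\<psi> \<in> auto ?F" using \<phi> A.inv_closed[of \<phi>] by (simp add: \<psi>_def car)
    have \<psi>\<phi>: "\<psi> (\<phi> w) = w" if "w \<in> carrier ?F" for w
    proof -
      have "(\<psi> \<otimes>\<^bsub>AutoGroup ?F\<^esub> \<phi>) w = \<one>\<^bsub>AutoGroup ?F\<^esub> w"
        using \<phi> by (simp add: \<psi>_def car)
      then show ?thesis using that \<phi> \<psi> by (simp add: mult) (simp add: AutoGroup_def BijGroup_def)
    qed
    have "\<exists>g\<in>carrier ?F. \<psi> (basis i) = inv\<^bsub>?F\<^esub> g \<otimes>\<^bsub>?F\<^esub> basis i \<otimes>\<^bsub>?F\<^esub> g" if i: "i \<in> {1..n}" for i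
    proof -
      note b = basis_in_carrier[OF i]
      obtain g where g: "g \<in> carrier ?F" "\<phi> (basis i) = inv\<^bsub>?F\<^esub> g \<otimes>\<^bsub>?F\<^esub> basis i \<otimes>\<^bsub>?F\<^esub> g"
        using \<phi> i by blast
      have e: "basis i = inv\<^bsub>?F\<^esub> \<psi> g \<otimes>\<^bsub>?F\<^esub> \<psi> (basis i) \<otimes>\<^bsub>?F\<^esub> \<psi> g"
        using \<psi>\<phi>[OF b] conj[OF \<psi> g(1) b] g(2) by simp
      have c: "\<psi> g \<in> carrier ?F" "\<psi> (basis i) \<in> carrier ?F"
        using closed \<psi> g b by auto
      have "\<psi> (basis i) = \<psi> g \<otimes>\<^bsub>?F\<^esub> basis i \<otimes>\<^bsub>?F\<^esub> inv\<^bsub>?F\<^esub> \<psi> g"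
        using c F.inv_closed[OF c(1)] arg_cong[OF e, of "\<lambda>z. \<psi> g \<otimes>\<^bsub>?F\<^esub> z \<otimes>\<^bsub>?F\<^esub> inv\<^bsub>?F\<^esub> \<psi> g"]
        by (simp add: F.m_assoc F.cancel_inv)
      then show ?thesis
        using c by (intro bexI[of _ "inv\<^bsub>?F\<^esub> \<psi> g"]) auto
    qed
    then show "inv\<^bsub>AutoGroup ?F\<^esub> \<phi> \<in> ?P" using \<psi> by (simp add: \<psi>_def)
  next
    fix \<phi> \<psi> assume \<phi>: "\<phi> \<in> ?P" and \<psi>: "\<psi> \<in> ?P"
    have "\<exists>g\<in>carrier ?F. (\<phi> \<otimes>\<^bsub>AutoGroup ?F\<^esub> \<psi>) (basis i) = inv\<^bsub>?F\<^esub> g \<otimes>\<^bsub>?F\<^esub> basis i \<otimes>\<^bsub>?F\<^esub> g"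
      if i: "i \<in> {1..n}" for i
    proof -
      note b = basis_in_carrier[OF i]
      obtain g where g: "g \<in> carrier ?F" "\<phi> (basis i) = inv\<^bsub>?F\<^esub> g \<otimes>\<^bsub>?F\<^esub> basis i \<otimes>\<^bsub>?F\<^esub> g"
        using \<phi> i by blast
      obtain h where h: "h \<in> carrier ?F" "\<psi> (basis i) = inv\<^bsub>?F\<^esub> h \<otimes>\<^bsub>?F\<^esub> basis i \<otimes>\<^bsub>?F\<^esub> h"
        using \<psi> i by blast
      have c: "\<phi> h \<in> carrier ?F" using closed \<phi> h b by auto
      have "(\<phi> \<otimes>\<^bsub>AutoGroup ?F\<^esub> \<psi>) (basis i) = inv\<^bsub>?F\<^esub> \<phi> h \<otimes>\<^bsub>?F\<^esub> (inv\<^bsub>?F\<^esub> g \<otimes>\<^bsub>?F\<^esub> basis i \<otimes>\<^bsub>?F\<^esub> g) \<otimes>\<^bsub>?F\<^esub> \<phi> h"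
        using \<phi> \<psi> b conj[of \<phi> h "basis i"] h g(2) by (simp add: mult)
      also have "\<dots> = inv\<^bsub>?F\<^esub> (g \<otimes>\<^bsub>?F\<^esub> \<phi> h) \<otimes>\<^bsub>?F\<^esub> basis i \<otimes>\<^bsub>?F\<^esub> (g \<otimes>\<^bsub>?F\<^esub> \<phi> h)"
        using c g(1) b by (simp add: F.inv_mult_group F.m_assoc)
      finally show ?thesis using c g(1) by blast
    qed
    moreover have "\<phi> \<otimes>\<^bsub>AutoGroup ?F\<^esub> \<psi> \<in> auto ?F"
      using \<phi> \<psi> A.m_closed by (simp add: car)
    ultimately show "\<phi> \<otimes>\<^bsub>AutoGroup ?F\<^esub> \<psi> \<in> ?P" by blast
  qed
  then show ?thesis
    unfolding PAut_def by (rule A.subgroup_imp_group)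
qed

lemma partial_conj_basis:
  assumes "i \<in> {1..n}" "j \<in> {1..n}" "k \<in> {1..n}"
  shows "partial_conj n i j (basis k) =
    (if k = i then inv\<^bsub>free_group n\<^esub> basis j \<otimes>\<^bsub>free_group n\<^esub> basis i \<otimes>\<^bsub>free_group n\<^esub> basis j
     else basis k)"
proof -
  interpret F: group "free_group n" by (rule group_free_group)
  show ?thesis
    unfolding partial_conj_def
    by (rule lift_basis) (use assms basis_in_carrier[of _ n] in \<open>auto intro: group_free_group\<close>)
qed

theorem partial_conj_in_PAut:
  assumes ij: "i \<in> {1..n}" "j \<in> {1..n}" "i \<noteq> j"
  shows "partial_conj n i j \<in> carrier (PAut n)"
proof -
  let ?F = "free_group n"
  interpret F: group ?F by (rule group_free_group)
  note b = basis_in_carrier[of _ n]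
  define c where "c = partial_conj n i j"
  define d where "d = lift ?F n (\<lambda>k. if k = i then basis j \<otimes>\<^bsub>?F\<^esub> basis i \<otimes>\<^bsub>?F\<^esub> inv\<^bsub>?F\<^esub> basis j else basis k)"
  have c_hom: "c \<in> hom ?F ?F" and d_hom: "d \<in> hom ?F ?F"
    unfolding c_def partial_conj_def d_def
    by (rule lift_hom; use ij b in \<open>auto intro: group_free_group\<close>)+
  interpret c: group_hom ?F ?F c using c_hom by unfold_locales
  interpret d: group_hom ?F ?F d using d_hom by unfold_locales
  have c_b: "c (basis k) = (if k = i then inv\<^bsub>?F\<^esub> basis j \<otimes>\<^bsub>?F\<^esub> basis i \<otimes>\<^bsub>?F\<^esub> basis j else basis k)"
    if "k \<in> {1..n}" for k
    using ij that unfolding c_def by (intro partial_conj_basis)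
  have d_b: "d (basis k) = (if k = i then basis j \<otimes>\<^bsub>?F\<^esub> basis i \<otimes>\<^bsub>?F\<^esub> inv\<^bsub>?F\<^esub> basis j else basis k)"
    if "k \<in> {1..n}" for k
    unfolding d_def by (rule lift_basis) (use ij that b in \<open>auto intro: group_free_group\<close>)
  have id_hom: "(\<lambda>w. w) \<in> hom ?F ?F" by (auto simp: hom_def)
  have dc: "d (c w) = w" if "w \<in> carrier ?F" for w
  proof (rule free_group_hom_unique[of ?F "\<lambda>w. d (c w)" n "\<lambda>w. w" w])
    show "(\<lambda>w. d (c w)) \<in> hom ?F ?F" by (auto simp: hom_def)
    fix k assume "k \<in> {1..n}"
    then show "d (c (basis k)) = basis k"
      using ij b by (auto simp: c_b d_b F.m_assoc F.cancel_inv)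
  qed (use that id_hom group_free_group in auto)
  have cd: "c (d w) = w" if "w \<in> carrier ?F" for w
  proof (rule free_group_hom_unique[of ?F "\<lambda>w. c (d w)" n "\<lambda>w. w" w])
    show "(\<lambda>w. c (d w)) \<in> hom ?F ?F" by (auto simp: hom_def)
    fix k assume "k \<in> {1..n}"
    then show "c (d (basis k)) = basis k"
      using ij b by (auto simp: c_b d_b F.m_assoc F.cancel_inv)
  qed (use that id_hom group_free_group in auto)
  have "bij_betw c (carrier ?F) (carrier ?F)"
    by (rule bij_betw_byWitness[where f' = d]) (auto simp: dc cd)
  moreover have "c \<in> extensional (carrier ?F)"
    by (simp add: c_def partial_conj_def lift_def)
  ultimately have "c \<in> auto ?F" using c_hom by (simp add: auto_def Bij_def)
  moreover have "\<exists>g\<in>carrier ?F. c (basis k) = inv\<^bsub>?F\<^esub> g \<otimes>\<^bsub>?F\<^esub> basis k \<otimes>\<^bsub>?F\<^esub> g"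
    if "k \<in> {1..n}" for k
  proof (cases "k = i")
    case True
    then show ?thesis using ij b c_b[OF that] by (intro bexI[of _ "basis j"]) auto
  next
    case False
    then show ?thesis using that b c_b[OF that] by (intro bexI[of _ "\<one>\<^bsub>?F\<^esub>"]) auto
  qed
  ultimately show ?thesis by (simp add: PAut_def c_def)
qed

text \<open>
  In rank 1 the group is trivial, so it has no action with non-abelian image.
\<close>

theorem PAut_1_trivial: "carrier (PAut 1) = {\<one>\<^bsub>PAut 1\<^esub>}"
proof -
  let ?F = "free_group 1"
  interpret F: group ?F by (rule group_free_group)
  interpret P: group "PAut 1" by (rule group_PAut)
  have b: "basis 1 \<in> carrier ?F" by (rule basis_in_carrier) simp
  have comm: "w \<otimes>\<^bsub>?F\<^esub> basis 1 = basis 1 \<otimes>\<^bsub>?F\<^esub> w" if "w \<in> carrier ?F" for w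
    using that
  proof (induction w)
    case Nil
    then show ?case using b F.l_one F.r_one by (simp add: free_group_def basis_def)
  next
    case (Cons x w)
    obtain a i where x: "x = (a, i)" by (cases x)
    note C = Cons_eq_mult[OF Cons.prems[unfolded x]]
    have i: "i = 1" using C(1) by simp
    define l where "l = (if a then basis 1 else inv\<^bsub>?F\<^esub> (basis 1))"
    have l: "l \<in> carrier ?F" "l \<otimes>\<^bsub>?F\<^esub> basis 1 = basis 1 \<otimes>\<^bsub>?F\<^esub> l" using b by (auto simp: l_def simp del: One_nat_def)
    have "l \<otimes>\<^bsub>?F\<^esub> w \<otimes>\<^bsub>?F\<^esub> basis 1 = l \<otimes>\<^bsub>?F\<^esub> (w \<otimes>\<^bsub>?F\<^esub> basis 1)"
      by (rule F.m_assoc[OF l(1) C(2) b])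
    also have "\<dots> = l \<otimes>\<^bsub>?F\<^esub> basis 1 \<otimes>\<^bsub>?F\<^esub> w"
      unfolding Cons.IH[OF C(2)] by (rule F.m_assoc[OF l(1) b C(2), symmetric])
    also have "\<dots> = basis 1 \<otimes>\<^bsub>?F\<^esub> (l \<otimes>\<^bsub>?F\<^esub> w)"
      unfolding l(2) by (rule F.m_assoc[OF b l(1) C(2)])
    finally have "l \<otimes>\<^bsub>?F\<^esub> w \<otimes>\<^bsub>?F\<^esub> basis 1 = basis 1 \<otimes>\<^bsub>?F\<^esub> (l \<otimes>\<^bsub>?F\<^esub> w)" .
    moreover have "x # w = l \<otimes>\<^bsub>?F\<^esub> w" using C(3) unfolding x i l_def .
    ultimately show ?case by metis
  qed
  have "\<phi> = \<one>\<^bsub>PAut 1\<^esub>" if \<phi>: "\<phi> \<in> carrier (PAut 1)" for \<phi>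
  proof -
    have au: "\<phi> \<in> auto ?F" using \<phi> by (simp add: PAut_def)
    have "1 \<in> {1..1::nat}" by simp
    then obtain g where g: "g \<in> carrier ?F" "\<phi> (basis 1) = inv\<^bsub>?F\<^esub> g \<otimes>\<^bsub>?F\<^esub> basis 1 \<otimes>\<^bsub>?F\<^esub> g"
      using \<phi> unfolding PAut_def by (auto simp del: One_nat_def)
    have "\<phi> (basis 1) = inv\<^bsub>?F\<^esub> g \<otimes>\<^bsub>?F\<^esub> (basis 1 \<otimes>\<^bsub>?F\<^esub> g)"
      unfolding g(2) by (intro F.m_assoc F.inv_closed g b)
    also have "\<dots> = basis 1"
      unfolding comm[OF g(1), symmetric] by (rule F.cancel_inv[OF g(1) b])
    finally have fix1: "\<phi> (basis 1) = basis 1" .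
    have "\<phi> w = w" if "w \<in> carrier ?F" for w
      by (rule free_group_hom_unique[of ?F \<phi> 1 "\<lambda>w. w"])
         (use au that fix1 in \<open>auto simp: auto_def hom_def intro: group_free_group\<close>)
    then have "\<phi> = (\<lambda>w\<in>carrier ?F. w)"
      using au by (intro extensionalityI[of _ "carrier ?F"]) (auto simp: auto_def Bij_def)
    then show ?thesis by (simp add: PAut_def AutoGroup_def BijGroup_def)
  qed
  then show ?thesis using P.one_closed by blast
qed


section \<open>CAT(0) spaces\<close>

definition geodesic_segment :: "'a metric \<Rightarrow> 'a \<Rightarrow> 'a \<Rightarrow> 'a set \<Rightarrow> bool" where
  "geodesic_segment X p q S \<longleftrightarrow> S \<subseteq> mspace X \<and>
     (\<exists>\<gamma>::real \<Rightarrow> 'a. \<gamma> 0 = p \<and> \<gamma> (mdist X p q) = q \<and> S = \<gamma> ` {0..mdist X p q} \<and>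
       (\<forall>s\<in>{0..mdist X p q}. \<forall>t\<in>{0..mdist X p q}. mdist X (\<gamma> s) (\<gamma> t) = \<bar>s - t\<bar>))"

definition geodesic_space :: "'a metric \<Rightarrow> bool" where
  "geodesic_space X \<longleftrightarrow> (\<forall>p\<in>mspace X. \<forall>q\<in>mspace X. \<exists>S. geodesic_segment X p q S)"

text \<open>
  The points of a side \<open>S\<close> from \<open>p\<close> to \<open>q\<close>, paired with their comparison points on the side
  from \<open>p'\<close> to \<open>q'\<close> of the comparison triangle in the Euclidean plane.
\<close>

definition comparison_pairs ::
    "'a metric \<Rightarrow> 'a \<Rightarrow> 'a \<Rightarrow> 'a set \<Rightarrow> real^2 \<Rightarrow> real^2 \<Rightarrow> ('a \<times> (real^2)) set" where
  "comparison_pairs X p q S p' q' =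
     {(x, x'). x \<in> S \<and> x' \<in> closed_segment p' q' \<and> dist p' x' = mdist X p x}"

text \<open>
  As in Bridson and Haefliger, a CAT(0) space is not required to be complete.
  Spaces are nonempty.
\<close>

definition CAT0 :: "'a metric \<Rightarrow> bool" where
  "CAT0 X \<longleftrightarrow> mspace X \<noteq> {} \<and> geodesic_space X \<and>
     (\<forall>p\<in>mspace X. \<forall>q\<in>mspace X. \<forall>r\<in>mspace X. \<forall>A B C. \<forall>p' q' r'.
        geodesic_segment X p q A \<and> geodesic_segment X q r B \<and> geodesic_segment X r p C \<and>
        dist p' q' = mdist X p q \<and> dist q' r' = mdist X q r \<and> dist r' p' = mdist X r p \<longrightarrow>
        (let T = comparison_pairs X p q A p' q' \<union> comparison_pairs X q r B q' r' \<union>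
                 comparison_pairs X r p C r' p'
         in \<forall>(x, x')\<in>T. \<forall>(y, y')\<in>T. mdist X x y \<le> dist x' y'))"


section \<open>Isometries\<close>

definition Isom :: "'a metric \<Rightarrow> ('a \<Rightarrow> 'a) monoid" where
  "Isom X = BijGroup (mspace X)
     \<lparr>carrier := {f \<in> Bij (mspace X).
        \<forall>x\<in>mspace X. \<forall>y\<in>mspace X. mdist X (f x) (f y) = mdist X x y}\<rparr>"

theorem group_Isom: "group (Isom X)"
proof -
  let ?M = "mspace X"
  interpret B: group "BijGroup ?M" by (rule group_BijGroup)
  let ?I = "{f \<in> Bij ?M. \<forall>x\<in>?M. \<forall>y\<in>?M. mdist X (f x) (f y) = mdist X x y}"
  have into: "f x \<in> ?M" if "f \<in> Bij ?M" "x \<in> ?M" for f x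
    using Bij_imp_funcset that by blast
  have "subgroup ?I (BijGroup ?M)"
  proof (rule B.subgroupI)
    show "?I \<subseteq> carrier (BijGroup ?M)" by (auto simp: BijGroup_def)
    have "(\<lambda>x\<in>?M. x) \<in> ?I" by (auto simp: id_Bij)
    then show "?I \<noteq> {}" by blast
  next
    fix f assume f: "f \<in> ?I"
    have "mdist X (inv_into ?M f x) (inv_into ?M f y) = mdist X x y"
      if "x \<in> ?M" "y \<in> ?M" for x y
    proof -
      have "f (inv_into ?M f z) = z" if "z \<in> ?M" for z
        using f that by (auto simp: Bij_def bij_betw_def f_inv_into_f)
      then show ?thesis
        using f that Bij_inv_into_mem[of f ?M x] Bij_inv_into_mem[of f ?M y] by fastforce
    qed
    then show "inv\<^bsub>BijGroup ?M\<^esub> f \<in> ?I"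
      using f by (auto simp: inv_BijGroup restrict_inv_into_Bij)
  next
    fix f g assume "f \<in> ?I" "g \<in> ?I"
    then show "f \<otimes>\<^bsub>BijGroup ?M\<^esub> g \<in> ?I"
      by (auto simp: BijGroup_def compose_Bij into) (simp add: compose_def into)
  qed
  then show ?thesis
    unfolding Isom_def by (rule B.subgroup_imp_group)
qed

definition displacement :: "'a metric \<Rightarrow> ('a \<Rightarrow> 'a) \<Rightarrow> 'a \<Rightarrow> real" where
  "displacement X g x = mdist X x (g x)"

definition hyperbolic_isometry :: "'a metric \<Rightarrow> ('a \<Rightarrow> 'a) \<Rightarrow> bool" where
  "hyperbolic_isometry X g \<longleftrightarrow> g \<in> carrier (Isom X) \<and>
     (\<exists>x\<in>mspace X. displacement X g x = (INF y\<in>mspace X. displacement X g y)) \<and>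
     (INF y\<in>mspace X. displacement X g y) > 0"


section \<open>Non-abelian groups\<close>

definition nonabelian_group :: "('a, 'b) monoid_scheme \<Rightarrow> bool" where
  "nonabelian_group G \<longleftrightarrow> group G \<and> \<not> comm_group G"

end

theory Submission
  imports Defs "HOL-Algebra.Elementary_Groups"
begin

text \<open>
  A Euclidean space suffices. If \<open>\<phi>\<close> sends \<open>v\<^sub>i\<close> to \<open>g\<^sub>i\<inverse> v\<^sub>i g\<^sub>i\<close>, the exponent sum in \<open>g\<^sub>i\<close> of the
  generators other than \<open>v\<^sub>i\<close>, summed over all \<open>i\<close>, is a homomorphism to the integers with value 1 on
  every partial conjugation; let \<open>\<phi>\<close> translate a line by it. Moreover \<open>\<phi>\<close> permutes the finitely many
  homomorphisms to the symmetric group of degree three that kill \<open>v\<^sub>3, \<dots>, v\<^sub>n\<close>, hence permutes the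
  coordinates of a Euclidean space and fixes its origin; this makes the image non-abelian. On
  the product of the two spaces the displacement is minimal at the origin, where it equals the
  translation length.
\<close>

section \<open>Euclidean spaces are CAT(0)\<close>

text \<open>
  The statement asks for a space whose points are sequences of reals, so a Euclidean space is
  transported along an injection \<open>k\<close>.
\<close>

definition transport_metric :: "('e::metric_space \<Rightarrow> 'a) \<Rightarrow> 'a metric" where
  "transport_metric k = metric (range k, \<lambda>x y. dist (inv_into UNIV k x) (inv_into UNIV k y))"

text \<open>\<open>Bij\<close> contains only extensional functions, hence the restriction to
  \<open>range k\<close>.\<close>

definition transport_map :: "('e \<Rightarrow> 'a) \<Rightarrow> ('e \<Rightarrow> 'e) \<Rightarrow> 'a \<Rightarrow> 'a" where
  "transport_map k f = (\<lambda>p\<in>range k. k (f (inv_into UNIV k p)))"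

lemma Metric_space_transport:
  fixes k :: "'e::metric_space \<Rightarrow> 'a"
  assumes "inj k"
  shows "Metric_space (range k) (\<lambda>x y. dist (inv_into UNIV k x) (inv_into UNIV k y))"
  by unfold_locales (use assms in \<open>auto simp: dist_commute dist_triangle\<close>)

lemma
  fixes k :: "'e::metric_space \<Rightarrow> 'a"
  assumes "inj k"
  shows mspace_transport [simp]: "mspace (transport_metric k) = range k"
    and mdist_transport: "mdist (transport_metric k) p q = dist (inv_into UNIV k p) (inv_into UNIV k q)"
  using Metric_space.mspace_metric[OF Metric_space_transport[OF assms]]
    Metric_space.mdist_metric[OF Metric_space_transport[OF assms]]
  by (simp_all add: transport_metric_def)

text \<open>Expand the square as inner products. With coefficients of sum zero the result is
  translation invariant, so only the three side lengths survive.\<close>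

lemma norm_combination_triangle:
  fixes p q r :: "'e::real_inner"
  assumes "a + b + c = 0"
  shows "(norm (a *\<^sub>R p + b *\<^sub>R q + c *\<^sub>R r))\<^sup>2 =
    - (a * b * (dist p q)\<^sup>2 + b * c * (dist q r)\<^sup>2 + c * a * (dist r p)\<^sup>2)"
proof -
  have c: "c = - a - b" using assms by simp
  show ?thesis
    unfolding c dist_norm power2_norm_eq_inner
    by (simp add: inner_simps inner_commute algebra_simps)
qed

text \<open>The difference of two affine combinations has coefficients of sum zero, so its norm is
  determined by the side lengths. For Euclidean triangles the CAT(0) comparison is thus an
  equality.\<close>

lemma dist_combination_triangle:
  fixes p q r :: "'e::real_inner" and p' q' r' :: "'f::real_inner"
  assumes "dist p' q' = dist p q" "dist q' r' = dist q r" "dist r' p' = dist r p"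
    and "a + b + c = 1" "a' + b' + c' = 1"
  shows "dist (a *\<^sub>R p + b *\<^sub>R q + c *\<^sub>R r) (a' *\<^sub>R p + b' *\<^sub>R q + c' *\<^sub>R r) =
    dist (a *\<^sub>R p' + b *\<^sub>R q' + c *\<^sub>R r') (a' *\<^sub>R p' + b' *\<^sub>R q' + c' *\<^sub>R r')"
proof -
  have s: "(a - a') + (b - b') + (c - c') = 0" using assms by simp
  have "norm ((a - a') *\<^sub>R p + (b - b') *\<^sub>R q + (c - c') *\<^sub>R r) =
      norm ((a - a') *\<^sub>R p' + (b - b') *\<^sub>R q' + (c - c') *\<^sub>R r')"
    by (rule power2_eq_imp_eq) (simp_all add: norm_combination_triangle[OF s] assms(1-3))
  then show ?thesis
    by (simp add: dist_norm scaleR_left_diff_distrib algebra_simps)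
qed

text \<open>Points of a geodesic give equality in the triangle inequality, which in a Euclidean
  space forces them onto the straight segment.\<close>

lemma geodesic_segment_transport:
  fixes k :: "'e::euclidean_space \<Rightarrow> 'a"
  assumes k: "inj k"
    and S: "geodesic_segment (transport_metric k) p q S"
    and x: "x \<in> S"
  shows "inv_into UNIV k x \<in> closed_segment (inv_into UNIV k p) (inv_into UNIV k q)"
proof -
  let ?h = "inv_into UNIV k"
  let ?d = "mdist (transport_metric k) p q"
  from S obtain \<gamma> where \<gamma>: "\<gamma> 0 = p" "\<gamma> ?d = q" "S = \<gamma> ` {0..?d}"
    "\<And>s t. s \<in> {0..?d} \<Longrightarrow> t \<in> {0..?d} \<Longrightarrow> mdist (transport_metric k) (\<gamma> s) (\<gamma> t) = \<bar>s - t\<bar>"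
    unfolding geodesic_segment_def by blast
  from x \<gamma>(3) obtain s where s: "s \<in> {0..?d}" "x = \<gamma> s" by blast
  have "dist (?h p) (?h x) = s" "dist (?h x) (?h q) = ?d - s"
    using \<gamma>(4)[of 0 s] \<gamma>(4)[of s ?d] \<gamma>(1,2) s by (auto simp: mdist_transport[OF k])
  then have "dist (?h p) (?h q) = dist (?h p) (?h x) + dist (?h x) (?h q)"
    by (simp add: mdist_transport[OF k])
  then show ?thesis by (simp flip: between between_mem_segment)
qed

text \<open>Both points lie at the same distance from the first endpoints of sides of equal length,
  so one parameter serves both.\<close>

lemma comparison_pairs_transport:
  fixes k :: "'e::euclidean_space \<Rightarrow> 'a"
  assumes k: "inj k"
    and S: "geodesic_segment (transport_metric k) p q S"
    and x: "(x, x') \<in> comparison_pairs (transport_metric k) p q S p' q'"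
    and d: "dist p' q' = mdist (transport_metric k) p q"
  obtains u where
    "inv_into UNIV k x = (1 - u) *\<^sub>R inv_into UNIV k p + u *\<^sub>R inv_into UNIV k q"
    "x' = (1 - u) *\<^sub>R p' + u *\<^sub>R q'"
proof -
  let ?h = "inv_into UNIV k"
  from x have xS: "x \<in> S" and x': "x' \<in> closed_segment p' q'" and e: "dist p' x' = dist (?h p) (?h x)"
    by (auto simp: comparison_pairs_def mdist_transport[OF k])
  obtain u where u: "0 \<le> u" "?h x = (1 - u) *\<^sub>R ?h p + u *\<^sub>R ?h q"
    using geodesic_segment_transport[OF k S xS] by (auto simp: in_segment)
  obtain v where v: "0 \<le> v" "x' = (1 - v) *\<^sub>R p' + v *\<^sub>R q'"
    using x' by (auto simp: in_segment)
  have dist_part: "dist a ((1 - t) *\<^sub>R a + t *\<^sub>R b) = t * dist a b" if "0 \<le> t"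
    for a b :: "'z::real_normed_vector" and t
  proof -
    have "a - ((1 - t) *\<^sub>R a + t *\<^sub>R b) = t *\<^sub>R (a - b)" by (simp add: algebra_simps)
    then show ?thesis using that by (simp add: dist_norm)
  qed
  have "v * dist p' q' = u * dist p' q'"
    using e d unfolding u(2) v(2) dist_part[OF u(1)] dist_part[OF v(1)] mdist_transport[OF k] by simp
  then have "x' = (1 - u) *\<^sub>R p' + u *\<^sub>R q'"
    \<comment> \<open>If \<open>p' = q'\<close>, then \<open>u\<close> and \<open>v\<close> may
      differ, but every combination equals \<open>p'\<close>.\<close>
    unfolding v(2) by (cases "p' = q'") (auto simp: algebra_simps)
  with u(2) that show thesis by blast
qed

theorem CAT0_transport:
  fixes k :: "'e::euclidean_space \<Rightarrow> 'a"
  assumes k: "inj k"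
  shows "CAT0 (transport_metric k)"
proof -
  let ?X = "transport_metric k" and ?h = "inv_into UNIV k"
  note md = mdist_transport[OF k]
  have "\<exists>S. geodesic_segment ?X p q S" if pq: "p \<in> range k" "q \<in> range k" for p q
  proof -
    obtain a b where p: "p = k a" and q: "q = k b" using pq by blast
    have d: "mdist ?X p q = dist a b" using k by (simp add: md p q)
    define \<gamma> where "\<gamma> = (\<lambda>t. k (a + (t / dist a b) *\<^sub>R (b - a)))"
    have "mdist ?X (\<gamma> s) (\<gamma> t) = \<bar>s - t\<bar>" if "s \<in> {0..dist a b}" "t \<in> {0..dist a b}" for s t
    proof (cases "a = b")
      case False
      have "mdist ?X (\<gamma> s) (\<gamma> t) = norm ((s / dist a b - t / dist a b) *\<^sub>R (b - a))"
        using k by (simp add: md \<gamma>_def dist_norm algebra_simps)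
      also have "\<dots> = \<bar>s - t\<bar> / dist a b * dist a b"
        by (simp add: dist_norm norm_minus_commute flip: diff_divide_distrib)
      finally show ?thesis using False by simp
    qed (use that k in \<open>auto simp: md \<gamma>_def\<close>)
    then have "geodesic_segment ?X p q (\<gamma> ` {0..dist a b})"
      unfolding geodesic_segment_def d
      by (intro conjI exI[of _ \<gamma>]) (auto simp: \<gamma>_def p q k)
    then show ?thesis ..
  qed
  then have "geodesic_space ?X" using k by (simp add: geodesic_space_def)
  moreover have main: "mdist ?X x y \<le> dist x' y'"
    if A: "geodesic_segment ?X p q A" and B: "geodesic_segment ?X q r B" and C: "geodesic_segment ?X r p C"
      and d: "dist p' q' = mdist ?X p q" "dist q' r' = mdist ?X q r" "dist r' p' = mdist ?X r p"
      and x: "(x, x') \<in> comparison_pairs ?X p q A p' q' \<union> comparison_pairs ?X q r B q' r' \<union>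
         comparison_pairs ?X r p C r' p'"
      and y: "(y, y') \<in> comparison_pairs ?X p q A p' q' \<union> comparison_pairs ?X q r B q' r' \<union>
         comparison_pairs ?X r p C r' p'"
    for p q r A B C p' q' r' x x' y y'
  proof -
    \<comment> \<open>Common barycentric coordinates for all three sides avoid a case split over the
      sides that contain \<open>x\<close> and \<open>y\<close>.\<close>
    have *: "\<exists>a b c. a + b + c = 1 \<and> ?h z = a *\<^sub>R ?h p + b *\<^sub>R ?h q + c *\<^sub>R ?h r \<and>
        z' = a *\<^sub>R p' + b *\<^sub>R q' + c *\<^sub>R r'"
      if "(z, z') \<in> comparison_pairs ?X p q A p' q' \<union> comparison_pairs ?X q r B q' r' \<union>
         comparison_pairs ?X r p C r' p'" for z z'
      using that
    proof (elim UnE)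
      assume "(z, z') \<in> comparison_pairs ?X p q A p' q'"
      from comparison_pairs_transport[OF k A this d(1)] obtain u where
        "?h z = (1 - u) *\<^sub>R ?h p + u *\<^sub>R ?h q" "z' = (1 - u) *\<^sub>R p' + u *\<^sub>R q'" .
      then show ?thesis by (intro exI[of _ "1 - u"] exI[of _ u] exI[of _ 0]) simp
    next
      assume "(z, z') \<in> comparison_pairs ?X q r B q' r'"
      from comparison_pairs_transport[OF k B this d(2)] obtain u where
        "?h z = (1 - u) *\<^sub>R ?h q + u *\<^sub>R ?h r" "z' = (1 - u) *\<^sub>R q' + u *\<^sub>R r'" .
      then show ?thesis by (intro exI[of _ 0] exI[of _ "1 - u"] exI[of _ u]) simp
    next
      assume "(z, z') \<in> comparison_pairs ?X r p C r' p'"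
      from comparison_pairs_transport[OF k C this d(3)] obtain u where
        "?h z = (1 - u) *\<^sub>R ?h r + u *\<^sub>R ?h p" "z' = (1 - u) *\<^sub>R r' + u *\<^sub>R p'" .
      then show ?thesis by (intro exI[of _ u] exI[of _ 0] exI[of _ "1 - u"]) (simp add: add.commute)
    qed
    obtain a b c where xabc: "a + b + c = 1" "?h x = a *\<^sub>R ?h p + b *\<^sub>R ?h q + c *\<^sub>R ?h r"
        "x' = a *\<^sub>R p' + b *\<^sub>R q' + c *\<^sub>R r'"
      using *[OF x] by blast
    obtain a' b' c' where yabc: "a' + b' + c' = 1" "?h y = a' *\<^sub>R ?h p + b' *\<^sub>R ?h q + c' *\<^sub>R ?h r"
        "y' = a' *\<^sub>R p' + b' *\<^sub>R q' + c' *\<^sub>R r'"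
      using *[OF y] by blast
    show ?thesis
      using dist_combination_triangle[OF d[unfolded md] xabc(1) yabc(1)]
      by (simp add: md xabc(2,3) yabc(2,3))
  qed
  ultimately show ?thesis
    unfolding CAT0_def Let_def using k
    by (intro conjI ballI allI impI) (simp, simp, clarify, rule main)
qed

text \<open>A vector is sent to its coordinates in an enumeration \<open>b\<close> of the basis;
  injectivity only requires that every basis vector occurs among the values of
  \<open>b\<close>.\<close>

lemma inj_euclidean_to_sequences: "\<exists>k :: 'e::euclidean_space \<Rightarrow> nat \<Rightarrow> real. inj k"
proof -
  obtain b :: "nat \<Rightarrow> 'e" where b: "b ` {..<DIM('e)} = (Basis :: 'e set)"
    using ex_bij_betw_nat_finite[OF finite_Basis]
    by (metis atLeast0LessThan bij_betw_imp_surj_on)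
  have "inj (\<lambda>(x::'e) i. x \<bullet> b i)"
  proof (rule injI)
    fix x y :: 'e assume "(\<lambda>i. x \<bullet> b i) = (\<lambda>i. y \<bullet> b i)"
    then have eq: "x \<bullet> b i = y \<bullet> b i" for i by meson
    show "x = y"
    proof (rule euclidean_eqI)
      fix u :: 'e assume "u \<in> Basis"
      then obtain i where "u = b i" using b by blast
      then show "x \<bullet> u = y \<bullet> u" using eq by simp
    qed
  qed
  then show ?thesis by blast
qed


section \<open>Isometric actions on the transported space\<close>

lemma transport_map_eq:
  "inj k \<Longrightarrow> transport_map k f (k x) = k (f x)"
  by (simp add: transport_map_def)

lemma transport_map_in_Isom:
  fixes k :: "'e::metric_space \<Rightarrow> 'a"
  assumes "inj k" "bij f" "\<And>x y. dist (f x) (f y) = dist x y"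
  shows "transport_map k f \<in> carrier (Isom (transport_metric k))"
proof -
  have "bij_betw (transport_map k f) (range k) (range k)"
  proof (rule bij_betw_imageI)
    show "inj_on (transport_map k f) (range k)"
      using assms(1) bij_is_inj[OF assms(2)]
      by (auto intro!: inj_onI simp: transport_map_eq inj_eq)
    have "transport_map k f ` range k = k ` range f"
      using assms(1) by (simp add: image_image transport_map_eq)
    then show "transport_map k f ` range k = range k"
      using bij_is_surj[OF assms(2)] by simp
  qed
  then show ?thesis
    using assms(1,3) by (auto simp: Isom_def Bij_def mdist_transport transport_map_eq)
      (simp add: transport_map_def)
qed

lemma transport_action_hom:
  fixes k :: "'e::metric_space \<Rightarrow> 'a" and G (structure)
  assumes "inj k" "group G"
    and mult: "\<And>g h x. g \<in> carrier G \<Longrightarrow> h \<in> carrier G \<Longrightarrow> F (g \<otimes> h) x = F g (F h x)"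
    and one: "\<And>x. F \<one> x = x"
    and iso: "\<And>g x y. g \<in> carrier G \<Longrightarrow> dist (F g x) (F g y) = dist x y"
  shows "(\<lambda>g. transport_map k (F g)) \<in> hom G (Isom (transport_metric k))"
proof (rule homI)
  interpret group G by fact
  show car: "transport_map k (F g) \<in> carrier (Isom (transport_metric k))" if g: "g \<in> carrier G" for g
  proof (rule transport_map_in_Isom)
    \<comment> \<open>The action of the inverse group element is a two-sided inverse of
      \<open>F g\<close>.\<close>
    show "bij (F g)"
      by (rule bij_betw_byWitness[where f' = "F (inv g)"])
        (use g one in \<open>auto simp flip: mult\<close>)
  qed (use assms g in auto)
  fix g h assume g: "g \<in> carrier G" and h: "h \<in> carrier G"
  have Bij: "transport_map k (F a) \<in> Bij (range k)" if "a \<in> carrier G" for a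
    using car[OF that] assms(1) by (simp add: Isom_def)
  have "compose (range k) (transport_map k (F g)) (transport_map k (F h)) = transport_map k (F (g \<otimes> h))"
    using assms(1) g h by (auto simp: compose_def fun_eq_iff transport_map_eq mult)
      (simp_all add: transport_map_def)
  then show "transport_map k (F (g \<otimes> h)) =
      transport_map k (F g) \<otimes>\<^bsub>Isom (transport_metric k)\<^esub> transport_map k (F h)"
    using Bij g h assms(1) by (simp add: Isom_def BijGroup_def)
qed

lemma transport_map_hyperbolic:
  fixes k :: "'e::metric_space \<Rightarrow> 'a"
  assumes "inj k" "transport_map k f \<in> carrier (Isom (transport_metric k))"
    and min: "\<And>x. dist x\<^sub>0 (f x\<^sub>0) \<le> dist x (f x)" and pos: "dist x\<^sub>0 (f x\<^sub>0) > 0"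
  shows "hyperbolic_isometry (transport_metric k) (transport_map k f)"
proof -
  have d: "displacement (transport_metric k) (transport_map k f) (k x) = dist x (f x)" for x
    using assms(1) by (simp add: displacement_def mdist_transport transport_map_eq)
  have "(INF p\<in>range k. displacement (transport_metric k) (transport_map k f) p) = dist x\<^sub>0 (f x\<^sub>0)"
    by (rule cInf_eq_minimum) (use min in \<open>auto simp: d image_image\<close>)
  then show ?thesis
    unfolding hyperbolic_isometry_def using assms(1,2) pos d by auto
qed


section \<open>The pure automorphism group\<close>

lemma PAut_hom: "\<phi> \<in> carrier (PAut n) \<Longrightarrow> \<phi> \<in> hom (free_group n) (free_group n)"
  by (simp add: PAut_def auto_def)

lemma PAut_closed:
  "\<phi> \<in> carrier (PAut n) \<Longrightarrow> w \<in> carrier (free_group n) \<Longrightarrow> \<phi> w \<in> carrier (free_group n)"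
  by (rule hom_in_carrier[OF PAut_hom])

lemma PAut_basis:
  assumes "\<phi> \<in> carrier (PAut n)" "i \<in> {1..n}"
  obtains g where "g \<in> carrier (free_group n)"
    "\<phi> (basis i) = inv\<^bsub>free_group n\<^esub> g \<otimes>\<^bsub>free_group n\<^esub> basis i \<otimes>\<^bsub>free_group n\<^esub> g"
proof -
  have "\<exists>g\<in>carrier (free_group n).
      \<phi> (basis i) = inv\<^bsub>free_group n\<^esub> g \<otimes>\<^bsub>free_group n\<^esub> basis i \<otimes>\<^bsub>free_group n\<^esub> g"
    using assms by (simp add: PAut_def del: atLeastAtMost_iff One_nat_def)
  with that show thesis by blast
qed

lemma PAut_mult:
  assumes "\<phi> \<in> carrier (PAut n)" "\<psi> \<in> carrier (PAut n)" "w \<in> carrier (free_group n)"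
  shows "(\<phi> \<otimes>\<^bsub>PAut n\<^esub> \<psi>) w = \<phi> (\<psi> w)"
  using assms by (simp add: PAut_def AutoGroup_def BijGroup_def compose_def auto_def)

lemma PAut_one: "w \<in> carrier (free_group n) \<Longrightarrow> \<one>\<^bsub>PAut n\<^esub> w = w"
  by (simp add: PAut_def AutoGroup_def BijGroup_def)

lemma free_group_hom_conj:
  assumes "group G" "h \<in> hom (free_group n) G"
    and "g \<in> carrier (free_group n)" "v \<in> carrier (free_group n)"
  shows "h (inv\<^bsub>free_group n\<^esub> g \<otimes>\<^bsub>free_group n\<^esub> v \<otimes>\<^bsub>free_group n\<^esub> g) =
    inv\<^bsub>G\<^esub> h g \<otimes>\<^bsub>G\<^esub> h v \<otimes>\<^bsub>G\<^esub> h g"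
proof -
  interpret group_hom "free_group n" G h
    using assms group_free_group by (simp add: group_hom_def group_hom_axioms_def)
  show ?thesis using assms(3,4) by simp
qed


section \<open>A homomorphism to the integers\<close>

text \<open>The integral Heisenberg group: \<open>(a, b, c)\<close> is the upper unitriangular 3 by
  3 matrix with \<open>a\<close>, \<open>b\<close> above the diagonal and \<open>c\<close> in the
  corner.\<close>

definition heisenberg :: "(int \<times> int \<times> int) monoid" where
  "heisenberg = \<lparr>carrier = UNIV,
     mult = (\<lambda>(a, b, c) (a', b', c'). (a + a', b + b', c + c' + a * b')), one = (0, 0, 0)\<rparr>"

lemma group_heisenberg: "group heisenberg"
proof (rule groupI)
  fix x assume "x \<in> carrier heisenberg"
  obtain a b c where "x = (a, b, c)" by (cases x)
  then show "\<exists>y\<in>carrier heisenberg. y \<otimes>\<^bsub>heisenberg\<^esub> x = \<one>\<^bsub>heisenberg\<^esub>"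
    by (intro bexI[of _ "(-a, -b, a * b - c)"]) (auto simp: heisenberg_def)
qed (auto simp: heisenberg_def algebra_simps)

text \<open>Conjugation changes \<open>(1, 0, 0)\<close> by a commutator, which is central and sees
  only \<open>b\<close>.\<close>

lemma heisenberg_conj:
  "inv\<^bsub>heisenberg\<^esub> (a, b, c) \<otimes>\<^bsub>heisenberg\<^esub> (1, 0, 0) \<otimes>\<^bsub>heisenberg\<^esub> (a, b, c) = (1, 0, b)"
proof -
  interpret group heisenberg by (rule group_heisenberg)
  have "inv\<^bsub>heisenberg\<^esub> (a, b, c) = (-a, -b, a * b - c)"
    by (rule inv_equality) (auto simp: heisenberg_def)
  then show ?thesis by (simp add: heisenberg_def algebra_simps)
qed

definition heis_rep :: "nat \<Rightarrow> nat \<Rightarrow> letter list \<Rightarrow> int \<times> int \<times> int" where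
  "heis_rep n i = lift heisenberg n (\<lambda>k. if k = i then (1, 0, 0) else (0, 1, 0))"

lemma heis_rep_hom: "heis_rep n i \<in> hom (free_group n) heisenberg"
  unfolding heis_rep_def by (rule lift_hom[OF group_heisenberg]) (simp add: heisenberg_def)

lemma heis_rep_basis:
  "k \<in> {1..n} \<Longrightarrow> heis_rep n i (basis k) = (if k = i then (1, 0, 0) else (0, 1, 0))"
  unfolding heis_rep_def by (subst lift_basis[OF group_heisenberg]) (simp_all add: heisenberg_def)

text \<open>The second Heisenberg coordinate is additive, and \<open>heis_rep\<close> gives it the
  value 1 on every generator except \<open>basis i\<close>, where it is 0. So this is the exponent
  sum of the other generators.\<close>

definition exp_sum :: "nat \<Rightarrow> nat \<Rightarrow> letter list \<Rightarrow> int" where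
  "exp_sum n i w = fst (snd (heis_rep n i w))"

lemma exp_sum_hom: "exp_sum n i \<in> hom (free_group n) integer_group"
  using heis_rep_hom[of n i]
  by (auto simp: hom_def exp_sum_def heisenberg_def case_prod_unfold)

text \<open>The target is abelian, so replacing generators by conjugates goes unnoticed.\<close>

lemma exp_sum_PAut:
  assumes \<phi>: "\<phi> \<in> carrier (PAut n)" and w: "w \<in> carrier (free_group n)"
  shows "exp_sum n i (\<phi> w) = exp_sum n i w"
proof (rule free_group_hom_unique[OF group_integer_group _ exp_sum_hom _ w])
  show "(\<lambda>w. exp_sum n i (\<phi> w)) \<in> hom (free_group n) integer_group"
    using hom_compose[OF PAut_hom[OF \<phi>] exp_sum_hom] by (simp add: comp_def)
  fix k assume k: "k \<in> {1..n}"
  obtain g where g: "g \<in> carrier (free_group n)"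
    "\<phi> (basis k) = inv\<^bsub>free_group n\<^esub> g \<otimes>\<^bsub>free_group n\<^esub> basis k \<otimes>\<^bsub>free_group n\<^esub> g"
    using PAut_basis[OF \<phi> k] .
  show "exp_sum n i (\<phi> (basis k)) = exp_sum n i (basis k)"
    unfolding g(2) free_group_hom_conj[OF group_integer_group exp_sum_hom g(1) basis_in_carrier[OF k]]
    by simp
qed

text \<open>
  If \<open>\<phi> v\<^sub>i = g\<inverse> v\<^sub>i g\<close>, then this is the exponent sum in \<open>g\<close> of the generators other than \<open>v\<^sub>i\<close>.
  Reading it off the central coordinate of the Heisenberg group shows that it does not
  depend on the choice of \<open>g\<close>.
\<close>

definition conj_exp :: "nat \<Rightarrow> nat \<Rightarrow> (letter list \<Rightarrow> letter list) \<Rightarrow> int" where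
  "conj_exp n i \<phi> = snd (snd (heis_rep n i (\<phi> (basis i))))"

lemma conj_exp_eq:
  assumes i: "i \<in> {1..n}" and g: "g \<in> carrier (free_group n)"
    and \<phi>: "\<phi> (basis i) = inv\<^bsub>free_group n\<^esub> g \<otimes>\<^bsub>free_group n\<^esub> basis i \<otimes>\<^bsub>free_group n\<^esub> g"
  shows "conj_exp n i \<phi> = exp_sum n i g"
proof -
  obtain a b c where abc: "heis_rep n i g = (a, b, c)" by (cases "heis_rep n i g")
  show ?thesis
    unfolding conj_exp_def \<phi> exp_sum_def
      free_group_hom_conj[OF group_heisenberg heis_rep_hom g basis_in_carrier[OF i]]
    using i by (simp add: abc heis_rep_basis heisenberg_conj)
qed

lemma conj_exp_mult:
  assumes i: "i \<in> {1..n}" and \<phi>: "\<phi> \<in> carrier (PAut n)" and \<psi>: "\<psi> \<in> carrier (PAut n)"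
  shows "conj_exp n i (\<phi> \<otimes>\<^bsub>PAut n\<^esub> \<psi>) = conj_exp n i \<phi> + conj_exp n i \<psi>"
proof -
  let ?F = "free_group n"
  interpret F: group ?F by (rule group_free_group)
  note b = basis_in_carrier[OF i]
  obtain g where g: "g \<in> carrier ?F" "\<phi> (basis i) = inv\<^bsub>?F\<^esub> g \<otimes>\<^bsub>?F\<^esub> basis i \<otimes>\<^bsub>?F\<^esub> g"
    using PAut_basis[OF \<phi> i] .
  obtain h where h: "h \<in> carrier ?F" "\<psi> (basis i) = inv\<^bsub>?F\<^esub> h \<otimes>\<^bsub>?F\<^esub> basis i \<otimes>\<^bsub>?F\<^esub> h"
    using PAut_basis[OF \<psi> i] .
  have c: "\<phi> h \<in> carrier ?F" by (rule PAut_closed[OF \<phi> h(1)])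
  \<comment> \<open>The conjugators compose as a crossed product; the twist of \<open>h\<close> by
    \<open>\<phi>\<close> then disappears by \<open>exp_sum_PAut\<close>.\<close>
  have "(\<phi> \<otimes>\<^bsub>PAut n\<^esub> \<psi>) (basis i) = inv\<^bsub>?F\<^esub> (g \<otimes>\<^bsub>?F\<^esub> \<phi> h) \<otimes>\<^bsub>?F\<^esub> basis i \<otimes>\<^bsub>?F\<^esub> (g \<otimes>\<^bsub>?F\<^esub> \<phi> h)"
    using free_group_hom_conj[OF group_free_group PAut_hom[OF \<phi>] h(1) b] c g b
    by (simp add: PAut_mult[OF \<phi> \<psi> b] h(2) F.inv_mult_group F.m_assoc)
  then have "conj_exp n i (\<phi> \<otimes>\<^bsub>PAut n\<^esub> \<psi>) = exp_sum n i (g \<otimes>\<^bsub>?F\<^esub> \<phi> h)"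
    using conj_exp_eq[OF i, of "g \<otimes>\<^bsub>?F\<^esub> \<phi> h" "\<phi> \<otimes>\<^bsub>PAut n\<^esub> \<psi>"] g(1) c by simp
  also have "\<dots> = exp_sum n i g + exp_sum n i (\<phi> h)"
    using hom_mult[OF exp_sum_hom g(1) c] by simp
  finally show ?thesis
    using conj_exp_eq[where \<phi> = \<phi>, OF i g] conj_exp_eq[where \<phi> = \<psi>, OF i h] exp_sum_PAut[OF \<phi> h(1)] by simp
qed

lemma conj_exp_partial_conj:
  assumes "k \<in> {1..n}" "i \<in> {1..n}" "j \<in> {1..n}" "i \<noteq> j"
  shows "conj_exp n k (partial_conj n i j) = (if k = i then 1 else 0)"
proof (cases "k = i")
  case True
  then show ?thesis
    using conj_exp_eq[of i n "basis j" "partial_conj n i j"] assms basis_in_carrier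
    by (simp add: partial_conj_basis exp_sum_def heis_rep_basis)
next
  case False
  then show ?thesis
    using assms by (simp add: conj_exp_def partial_conj_basis heis_rep_basis)
qed

text \<open>A partial conjugation \<open>c_ij\<close> contributes only to the summand of index
  \<open>i\<close>; summing over all indices gives every \<open>c_ij\<close> the same nonzero
  value.\<close>

definition total_exp :: "nat \<Rightarrow> (letter list \<Rightarrow> letter list) \<Rightarrow> int" where
  "total_exp n \<phi> = (\<Sum>i\<in>{1..n}. conj_exp n i \<phi>)"

lemma total_exp_mult:
  "\<phi> \<in> carrier (PAut n) \<Longrightarrow> \<psi> \<in> carrier (PAut n) \<Longrightarrow>
    total_exp n (\<phi> \<otimes>\<^bsub>PAut n\<^esub> \<psi>) = total_exp n \<phi> + total_exp n \<psi>"
  by (simp add: total_exp_def conj_exp_mult sum.distrib)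

lemma total_exp_one: "total_exp n \<one>\<^bsub>PAut n\<^esub> = 0"
  using basis_in_carrier
  by (auto simp: total_exp_def conj_exp_def PAut_one heis_rep_basis intro!: sum.neutral)

lemma total_exp_partial_conj:
  "i \<in> {1..n} \<Longrightarrow> j \<in> {1..n} \<Longrightarrow> i \<noteq> j \<Longrightarrow> total_exp n (partial_conj n i j) = 1"
  by (simp add: total_exp_def conj_exp_partial_conj)


section \<open>The action on pairs of elements of the symmetric group of degree three\<close>

text \<open>The pair \<open>(s, t)\<close> stands for the map \<open>x \<mapsto> \<plusminus>x + t\<close> of the integers modulo 3, with sign \<open>-\<close> if \<open>s\<close>.\<close>

definition S3 :: "(bool \<times> 3) monoid" where
  "S3 = \<lparr>carrier = UNIV, mult = (\<lambda>(s, x) (t, y). (s \<noteq> t, x + (if s then - y else y))), one = (False, 0)\<rparr>"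

lemma S3_mult: "(s, x) \<otimes>\<^bsub>S3\<^esub> (t, y) = (s \<noteq> t, x + (if s then - y else y))"
  by (simp add: S3_def)

lemma S3_left_inv: "(s, if s then x else - x) \<otimes>\<^bsub>S3\<^esub> (s, x) = \<one>\<^bsub>S3\<^esub>"
  by (simp add: S3_def)

lemma group_S3: "group S3"
proof (rule groupI)
  fix x assume "x \<in> carrier S3"
  obtain s t where "x = (s, t)" by (cases x)
  then show "\<exists>y\<in>carrier S3. y \<otimes>\<^bsub>S3\<^esub> x = \<one>\<^bsub>S3\<^esub>"
    using S3_left_inv[of s t] by (intro bexI[of _ "(s, if s then t else - t)"]) (auto simp: S3_def)
qed (auto simp: S3_def)

lemma S3_inv: "inv\<^bsub>S3\<^esub> (s, x) = (s, if s then x else - x)"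
  by (rule group.inv_equality[OF group_S3 S3_left_inv]) (simp_all add: S3_def)

definition S3_rep :: "nat \<Rightarrow> (bool \<times> 3) \<times> (bool \<times> 3) \<Rightarrow> letter list \<Rightarrow> bool \<times> 3" where
  "S3_rep n t = lift S3 n (\<lambda>k. if k = 1 then fst t else if k = 2 then snd t else \<one>\<^bsub>S3\<^esub>)"

lemma S3_rep_hom: "S3_rep n t \<in> hom (free_group n) S3"
  unfolding S3_rep_def by (rule lift_hom[OF group_S3]) (simp add: S3_def)

lemma S3_rep_basis:
  "k \<in> {1..n} \<Longrightarrow>
    S3_rep n t (basis k) = (if k = 1 then fst t else if k = 2 then snd t else \<one>\<^bsub>S3\<^esub>)"
  unfolding S3_rep_def by (subst lift_basis[OF group_S3]) (simp_all add: S3_def)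

text \<open>
  Pairs of elements of \<open>S3\<close> are identified with the homomorphisms from the free group that kill
  \<open>v\<^sub>3, \<dots>, v\<^sub>n\<close>. Since pure automorphisms map each of these to a conjugate of itself, precomposition
  preserves this set; it is a right action.
\<close>

definition S3_act ::
    "nat \<Rightarrow> (letter list \<Rightarrow> letter list) \<Rightarrow> (bool \<times> 3) \<times> (bool \<times> 3) \<Rightarrow> (bool \<times> 3) \<times> (bool \<times> 3)" where
  "S3_act n \<phi> t = (S3_rep n t (\<phi> (basis 1)), S3_rep n t (\<phi> (basis 2)))"

lemma S3_rep_act:
  assumes \<phi>: "\<phi> \<in> carrier (PAut n)" and w: "w \<in> carrier (free_group n)"
  shows "S3_rep n (S3_act n \<phi> t) w = S3_rep n t (\<phi> w)"
proof (rule free_group_hom_unique[OF group_S3 S3_rep_hom _ _ w])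
  interpret S: group S3 by (rule group_S3)
  show "(\<lambda>w. S3_rep n t (\<phi> w)) \<in> hom (free_group n) S3"
    using hom_compose[OF PAut_hom[OF \<phi>] S3_rep_hom] by (simp add: comp_def)
  fix k assume k: "k \<in> {1..n}"
  obtain g where g: "g \<in> carrier (free_group n)"
    "\<phi> (basis k) = inv\<^bsub>free_group n\<^esub> g \<otimes>\<^bsub>free_group n\<^esub> basis k \<otimes>\<^bsub>free_group n\<^esub> g"
    using PAut_basis[OF \<phi> k] .
  \<comment> \<open>Purity enters here: a conjugate of a killed generator is killed.\<close>
  have "S3_rep n t (\<phi> (basis k)) = \<one>\<^bsub>S3\<^esub>" if "k \<noteq> 1" "k \<noteq> 2"
    unfolding g(2) free_group_hom_conj[OF group_S3 S3_rep_hom g(1) basis_in_carrier[OF k]]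
    using that k hom_in_carrier[OF S3_rep_hom g(1)] by (simp add: S3_rep_basis)
  then show "S3_rep n (S3_act n \<phi> t) (basis k) = S3_rep n t (\<phi> (basis k))"
    using k by (simp add: S3_rep_basis) (simp add: S3_act_def)
qed

text \<open>Precomposition reverses the order. The bound on \<open>n\<close> puts
  \<open>basis 1\<close> and \<open>basis 2\<close> in the free group.\<close>

lemma S3_act_mult:
  assumes "n \<ge> 2" "\<phi> \<in> carrier (PAut n)" "\<psi> \<in> carrier (PAut n)"
  shows "S3_act n (\<phi> \<otimes>\<^bsub>PAut n\<^esub> \<psi>) t = S3_act n \<psi> (S3_act n \<phi> t)"
  using assms basis_in_carrier[of _ n]
  by (simp add: S3_act_def[of n "\<phi> \<otimes>\<^bsub>PAut n\<^esub> \<psi>" t] S3_act_def[of n \<psi> "S3_act n \<phi> t"]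
      PAut_mult PAut_closed S3_rep_act)

lemma S3_act_one: "n \<ge> 2 \<Longrightarrow> S3_act n \<one>\<^bsub>PAut n\<^esub> t = t"
  using basis_in_carrier[of _ n] by (simp add: S3_act_def PAut_one S3_rep_basis)

lemma bij_S3_act:
  assumes "n \<ge> 2" "\<phi> \<in> carrier (PAut n)"
  shows "bij (S3_act n \<phi>)"
proof -
  interpret P: group "PAut n" by (rule group_PAut)
  show ?thesis
    by (rule bij_betw_byWitness[where f' = "S3_act n (inv\<^bsub>PAut n\<^esub> \<phi>)"])
      (use assms in \<open>auto simp: S3_act_one simp flip: S3_act_mult\<close>)
qed

lemma S3_act_partial_conj:
  assumes "n \<ge> 2"
  shows "S3_act n (partial_conj n 1 2) (a, b) = (inv\<^bsub>S3\<^esub> b \<otimes>\<^bsub>S3\<^esub> a \<otimes>\<^bsub>S3\<^esub> b, b)"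
    and "S3_act n (partial_conj n 2 1) (a, b) = (a, inv\<^bsub>S3\<^esub> a \<otimes>\<^bsub>S3\<^esub> b \<otimes>\<^bsub>S3\<^esub> a)"
  using assms basis_in_carrier[of 1 n] basis_in_carrier[of 2 n]
  by (simp_all add: S3_act_def partial_conj_basis S3_rep_basis
      free_group_hom_conj[OF group_S3 S3_rep_hom])

text \<open>Conjugating one of two distinct reflections by the other gives the third. Labelling
  reflections by their translation parts, the pair (0, 1) goes to (2, 0) in one order and to (1, 2)
  in the other.\<close>

lemma S3_act_noncommuting:
  assumes "n \<ge> 2"
  shows "S3_act n (partial_conj n 2 1) (S3_act n (partial_conj n 1 2) ((True, 0), (True, 1))) \<noteq>
    S3_act n (partial_conj n 1 2) (S3_act n (partial_conj n 2 1) ((True, 0), (True, 1)))"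
  unfolding S3_act_partial_conj[OF assms] by (simp add: S3_inv S3_mult)


section \<open>The action on Euclidean space\<close>

lemma norm_vec_reindex:
  assumes "bij \<pi>"
  shows "norm (\<chi> t. (f :: real^'n) $ \<pi> t) = norm f"
  using sum.reindex_bij_betw[OF assms, of "\<lambda>t. (f $ t)\<^sup>2"] by (simp add: norm_vec_def L2_set_def)

text \<open>Reindexing coordinates by the right action \<open>S3_act\<close> produces a left action
  on vectors.\<close>

definition euclidean_act :: "nat \<Rightarrow> (letter list \<Rightarrow> letter list) \<Rightarrow>
    real \<times> (real^((bool \<times> 3) \<times> (bool \<times> 3))) \<Rightarrow> real \<times> (real^((bool \<times> 3) \<times> (bool \<times> 3)))" where
  "euclidean_act n \<phi> z = (fst z + of_int (total_exp n \<phi>), \<chi> t. snd z $ S3_act n \<phi> t)"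

lemma euclidean_act_mult:
  assumes "n \<ge> 2" "\<phi> \<in> carrier (PAut n)" "\<psi> \<in> carrier (PAut n)"
  shows "euclidean_act n (\<phi> \<otimes>\<^bsub>PAut n\<^esub> \<psi>) z = euclidean_act n \<phi> (euclidean_act n \<psi> z)"
  using assms by (simp add: euclidean_act_def total_exp_mult S3_act_mult)

lemma euclidean_act_one: "n \<ge> 2 \<Longrightarrow> euclidean_act n \<one>\<^bsub>PAut n\<^esub> z = z"
  by (simp add: euclidean_act_def total_exp_one S3_act_one)

lemma euclidean_act_dist:
  assumes "n \<ge> 2" "\<phi> \<in> carrier (PAut n)"
  shows "dist (euclidean_act n \<phi> y) (euclidean_act n \<phi> z) = dist y z"
proof -
  have "(\<chi> t. snd y $ S3_act n \<phi> t) - (\<chi> t. snd z $ S3_act n \<phi> t) = (\<chi> t. (snd y - snd z) $ S3_act n \<phi> t)"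
    by (simp add: vec_eq_iff)
  then have "dist (\<chi> t. snd y $ S3_act n \<phi> t) (\<chi> t. snd z $ S3_act n \<phi> t) = dist (snd y) (snd z)"
    using norm_vec_reindex[OF bij_S3_act[OF assms]] by (simp only: dist_norm)
  then show ?thesis by (simp add: euclidean_act_def dist_prod_def dist_norm)
qed

text \<open>Projection to the line does not increase distances, which gives the lower bound; at 0
  the permuted coordinates do not move.\<close>

lemma euclidean_act_displacement:
  "dist 0 (euclidean_act n \<phi> 0) = \<bar>of_int (total_exp n \<phi>)\<bar>"
  "\<bar>of_int (total_exp n \<phi>)\<bar> \<le> dist z (euclidean_act n \<phi> z)"
proof -
  have "(\<chi> t. 0) = (0 :: real^((bool \<times> 3) \<times> (bool \<times> 3)))" by (simp add: vec_eq_iff)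
  then show "dist 0 (euclidean_act n \<phi> 0) = \<bar>of_int (total_exp n \<phi>)\<bar>"
    by (simp add: euclidean_act_def dist_prod_def dist_norm)
  show "\<bar>of_int (total_exp n \<phi>)\<bar> \<le> dist z (euclidean_act n \<phi> z)"
    using dist_fst_le[of z "euclidean_act n \<phi> z"] by (simp add: euclidean_act_def dist_norm)
qed

lemma PAut_nonabelian_hyperbolic_action:
  fixes n :: nat
  assumes n: "n \<ge> 2"
  shows "\<exists>(X :: (nat \<Rightarrow> real) metric) \<Phi>.
    CAT0 X \<and>
    \<Phi> \<in> hom (PAut n) (Isom X) \<and>
    nonabelian_group ((Isom X)\<lparr>carrier := \<Phi> ` carrier (PAut n)\<rparr>) \<and>
    (\<forall>i\<in>{1..n}. \<forall>j\<in>{1..n}. i \<noteq> j \<longrightarrow> hyperbolic_isometry X (\<Phi> (partial_conj n i j)))"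
proof -
  obtain k :: "real \<times> (real^((bool \<times> 3) \<times> (bool \<times> 3))) \<Rightarrow> nat \<Rightarrow> real" where k: "inj k"
    using inj_euclidean_to_sequences by blast
  define X where "X = transport_metric k"
  define \<Phi> where "\<Phi> = (\<lambda>\<phi>. transport_map k (euclidean_act n \<phi>))"
  have hom: "\<Phi> \<in> hom (PAut n) (Isom X)"
    unfolding \<Phi>_def X_def
    by (rule transport_action_hom[OF k group_PAut])
      (use n euclidean_act_mult euclidean_act_one euclidean_act_dist in auto)
  interpret \<Phi>: group_hom "PAut n" "Isom X" \<Phi>
    using hom group_PAut group_Isom by (simp add: group_hom_def group_hom_axioms_def)
  define c where "c = partial_conj n 1 2"
  define d where "d = partial_conj n 2 1"
  have cd: "c \<in> carrier (PAut n)" "d \<in> carrier (PAut n)"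
    unfolding c_def d_def using n by (auto intro!: partial_conj_in_PAut)
  have "\<Phi> (c \<otimes>\<^bsub>PAut n\<^esub> d) \<noteq> \<Phi> (d \<otimes>\<^bsub>PAut n\<^esub> c)"
  proof
    assume eq: "\<Phi> (c \<otimes>\<^bsub>PAut n\<^esub> d) = \<Phi> (d \<otimes>\<^bsub>PAut n\<^esub> c)"
    have act_eq: "euclidean_act n (c \<otimes>\<^bsub>PAut n\<^esub> d) z = euclidean_act n (d \<otimes>\<^bsub>PAut n\<^esub> c) z" for z
      using fun_cong[OF eq, of "k z"] k by (simp add: \<Phi>_def transport_map_eq inj_eq)
    define t where "t = ((True, 0 :: 3), (True, 1 :: 3))"
    define s where "s = S3_act n d (S3_act n c t)"
    \<comment> \<open>Coordinate \<open>t\<close> of the two images of the unit vector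
      \<open>axis s 1\<close>: by the choice of \<open>s\<close> the left side is 1, while the right
      side is 0 because the other order sends \<open>t\<close> elsewhere.\<close>
    have "axis s (1::real) $ S3_act n d (S3_act n c t) = axis s 1 $ S3_act n c (S3_act n d t)"
      using act_eq[of "(0, axis s 1)"] n cd
      by (simp add: euclidean_act_def S3_act_mult vec_eq_iff del: split_paired_All)
    moreover have "S3_act n c (S3_act n d t) \<noteq> s"
      using S3_act_noncommuting[OF n] unfolding s_def c_def d_def t_def by metis
    ultimately show False by (simp add: axis_def flip: s_def)
  qed
  then have "\<Phi> c \<otimes>\<^bsub>Isom X\<^esub> \<Phi> d \<noteq> \<Phi> d \<otimes>\<^bsub>Isom X\<^esub> \<Phi> c"
    using cd by simp
  then have "\<not> comm_group ((Isom X)\<lparr>carrier := \<Phi> ` carrier (PAut n)\<rparr>)"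
    using cd comm_groupE(4)[of "(Isom X)\<lparr>carrier := \<Phi> ` carrier (PAut n)\<rparr>" "\<Phi> c" "\<Phi> d"] by auto
  moreover have "group ((Isom X)\<lparr>carrier := \<Phi> ` carrier (PAut n)\<rparr>)"
    by (rule \<Phi>.H.subgroup_imp_group[OF \<Phi>.img_is_subgroup])
  moreover have "hyperbolic_isometry X (\<Phi> (partial_conj n i j))"
    if ij: "i \<in> {1..n}" "j \<in> {1..n}" "i \<noteq> j" for i j
    unfolding X_def \<Phi>_def
  proof (rule transport_map_hyperbolic[OF k, where x\<^sub>0 = 0])
    show "transport_map k (euclidean_act n (partial_conj n i j)) \<in> carrier (Isom (transport_metric k))"
      using \<Phi>.hom_closed[OF partial_conj_in_PAut[OF ij]] by (simp add: \<Phi>_def X_def)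
    show "0 < dist 0 (euclidean_act n (partial_conj n i j) 0)"
      unfolding euclidean_act_displacement total_exp_partial_conj[OF ij] by simp
    show "dist 0 (euclidean_act n (partial_conj n i j) 0) \<le> dist x (euclidean_act n (partial_conj n i j) x)" for x
      by (simp only: euclidean_act_displacement)
  qed
  moreover have "CAT0 X" unfolding X_def by (rule CAT0_transport[OF k])
  ultimately show ?thesis using hom unfolding nonabelian_group_def by blast
qed

text \<open>The non-abelian clause is restricted to \<open>n \<ge> 2\<close> because
  \<open>PAut 1\<close> is trivial by \<open>PAut_1_trivial\<close>.\<close>

theorem corollary1p3:
  fixes n :: nat
  assumes "n > 0"
  shows "\<exists>(X :: (nat \<Rightarrow> real) metric) \<Phi>.
    CAT0 X \<and>
    \<Phi> \<in> hom (PAut n) (Isom X) \<and>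
    (n \<ge> 2 \<longrightarrow> nonabelian_group ((Isom X)\<lparr>carrier := \<Phi> ` carrier (PAut n)\<rparr>)) \<and>
    (\<forall>i\<in>{1..n}. \<forall>j\<in>{1..n}. i \<noteq> j \<longrightarrow> hyperbolic_isometry X (\<Phi> (partial_conj n i j)))"
proof (cases "n \<ge> 2")
  case True
  then show ?thesis using PAut_nonabelian_hyperbolic_action[OF True] by blast
next
  case False
  then have n: "n = 1" using assms by simp
  obtain k :: "real \<Rightarrow> nat \<Rightarrow> real" where k: "inj k"
    using inj_euclidean_to_sequences by blast
  \<comment> \<open>For \<open>n = 1\<close> the trivial action on a line suffices: there are no
    indices \<open>i \<noteq> j\<close>, so the hyperbolicity clause is vacuous.\<close>
  have "(\<lambda>\<phi>. transport_map k (\<lambda>x. x)) \<in> hom (PAut n) (Isom (transport_metric k))"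
    by (rule transport_action_hom[OF k group_PAut]) auto
  then show ?thesis using CAT0_transport[OF k] n by auto
qed

end
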